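(* Let $B$ be the bull. Then $rb(K_5,B)=6$ and $rb(K_n,B) = n+2$ for all $n \geq 6$.
   Context: The bull $B$ is the unique graph with $5$ vertices and degree sequence $(1,1,2,3,3)$ (a triangle with pendant edges attached at two distinct vertices). For a graph $H$ and an integer $n$, the rainbow number $rb(K_n,H)$ is the minimum number $m$ such that every edge-colouring of $K_n$ using at least $m$ colours contains a rainbow copy of $H$, i.e. a subgraph isomorphic to $H$ whose edges all have distinct colours. *)

theory Defs
  imports Main
begin

text \<open>Finite simple graphs are pairs of a vertex set and a set of two-element edges.\<close>

type_synonym 'a graph = "'a set \<times> 'a set set"

abbreviation verts :: "'a graph \<Rightarrow> 'a set" where
  "verts G \<equiv> fst G"

abbreviation edges :: "'a graph \<Rightarrow> 'a set set" where
  "edges G \<equiv> snd G"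

definition simple_graph :: "'a graph \<Rightarrow> bool" where
  "simple_graph G \<longleftrightarrow> finite (verts G) \<and> (\<forall>e\<in>edges G. e \<subseteq> verts G \<and> card e = 2)"

definition subgraph :: "'a graph \<Rightarrow> 'a graph \<Rightarrow> bool" where
  "subgraph S G \<longleftrightarrow> simple_graph S \<and> verts S \<subseteq> verts G \<and> edges S \<subseteq> edges G"

definition isomorphic :: "'a graph \<Rightarrow> 'b graph \<Rightarrow> bool" where
  "isomorphic G H \<longleftrightarrow>
     (\<exists>f. bij_betw f (verts G) (verts H) \<and>
          (\<forall>u\<in>verts G. \<forall>v\<in>verts G. {u, v} \<in> edges G \<longleftrightarrow> {f u, f v} \<in> edges H))"

definition degree :: "'a graph \<Rightarrow> 'a \<Rightarrow> nat" where
  "degree G v = card {e \<in> edges G. v \<in> e}"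

definition complete_graph :: "nat \<Rightarrow> nat graph" where
  "complete_graph n = ({..<n}, {e. e \<subseteq> {..<n} \<and> card e = 2})"

definition bull :: "nat graph" where
  "bull = ({0, 1, 2, 3, 4}, {{0, 1}, {1, 2}, {0, 2}, {0, 3}, {1, 4}})"

text \<open>An edge-colouring of \<open>G\<close> is a function \<open>c\<close> on edges, of which only the values on
  \<open>edges G\<close> matter; it uses \<open>card (c ` edges G)\<close> colours. As \<open>G\<close> is finite, taking the colours
  to be natural numbers is no restriction.\<close>

definition has_rainbow_copy :: "'a graph \<Rightarrow> ('a set \<Rightarrow> nat) \<Rightarrow> 'b graph \<Rightarrow> bool" where
  "has_rainbow_copy G c H \<longleftrightarrow> (\<exists>S. subgraph S G \<and> isomorphic S H \<and> inj_on c (edges S))"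

text \<open>For finite \<open>G\<close> the minimum exists: the condition holds vacuously once \<open>m\<close> exceeds the
  number of edges of \<open>G\<close>.\<close>

definition rainbow_number :: "'a graph \<Rightarrow> 'b graph \<Rightarrow> nat" where
  "rainbow_number G H =
     (LEAST m. \<forall>c. m \<le> card (c ` edges G) \<longrightarrow> has_rainbow_copy G c H)"

lemma simple_graph_complete_graph: "simple_graph (complete_graph n)"
  by (auto simp: simple_graph_def complete_graph_def)

lemma simple_graph_bull: "simple_graph bull"
  by (auto simp: simple_graph_def bull_def)

lemma bull_degree_sequence: "map (degree bull) [3, 4, 2, 0, 1] = [1, 1, 2, 3, 3]"
proof -
  have *: "{e \<in> insert a A. v \<in> e} = (if v \<in> a then insert a {e \<in> A. v \<in> e} else {e \<in> A. v \<in> e})"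
    for a :: "nat set" and A v by auto
  have **: "{e \<in> {}. v \<in> e} = {}" for v :: nat by simp
  show ?thesis
    unfolding degree_def bull_def snd_conv list.map * **
    by (simp add: card_insert_if doubleton_eq_iff)
qed

end

theory Submission
  imports Defs
begin

text \<open>Call a colour saturated at \<open>v\<close> if it occurs only on edges at \<open>v\<close>. Deleting a vertex with at most
  one saturated colour reduces the upper bound for \<open>n\<close> to \<open>n - 1\<close>, down to a direct analysis of
  \<open>K\<^sub>5\<close>. If every vertex has at least two saturated colours, two edges \<open>va\<close>, \<open>vb\<close> with such colours
  close up to a rainbow triangle, and forbidding rainbow bulls on these triangles forces exactly two
  saturated colours at each vertex, each used on a single edge, the edges in question forming
  triangles and 4-cycles, while all other edges share one colour. That leaves only \<open>n + 1\<close> colours.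
  Conversely, for \<open>n \<ge> 6\<close> the vertices can be covered by disjoint triangles and 4-cycles; giving
  their \<open>n\<close> edges distinct colours and all other edges one more colour creates no rainbow bull, as a
  bull minus an edge has a component that is not contained in a triangle or a 4-cycle.
  For \<open>n = 5\<close> use a 4-cycle and an isolated vertex.\<close>

section \<open>Saturated colours\<close>

text \<open>Colourings are treated as functions of two vertices, so that the same \<open>d\<close>
  serves for every smaller vertex set; \<open>image_edges_complete_graph\<close> links this to
  colourings of edges.\<close>

definition colours :: "('a \<Rightarrow> 'a \<Rightarrow> 'b) \<Rightarrow> 'a set \<Rightarrow> 'b set" where
  "colours d V = {d u v | u v. u \<in> V \<and> v \<in> V \<and> u \<noteq> v}"

lemma coloursI: "u \<in> V \<Longrightarrow> v \<in> V \<Longrightarrow> u \<noteq> v \<Longrightarrow> d u v \<in> colours d V"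
  by (auto simp: colours_def)

lemma finite_colours: "finite V \<Longrightarrow> finite (colours d V)"
  by (rule finite_subset[of _ "(\<lambda>(u, v). d u v) ` (V \<times> V)"]) (auto simp: colours_def)

definition saturated :: "('a \<Rightarrow> 'a \<Rightarrow> 'b) \<Rightarrow> 'a set \<Rightarrow> 'a \<Rightarrow> 'b set" where
  "saturated d V v = colours d V - colours d (V - {v})"

lemma saturated_avoids:
  "\<lbrakk>x \<in> saturated d V v; u \<in> V; w \<in> V; u \<noteq> w; u \<noteq> v; w \<noteq> v\<rbrakk> \<Longrightarrow> d u w \<noteq> x"
  unfolding saturated_def by (metis DiffE DiffI coloursI singletonD)

lemma saturated_edge:
  assumes "x \<in> saturated d V v" "\<And>u w. d u w = d w u"
  obtains a where "a \<in> V" "a \<noteq> v" "v \<in> V" "x = d v a"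
proof -
  obtain u w where uw: "x = d u w" "u \<in> V" "w \<in> V" "u \<noteq> w"
    using assms(1) by (auto simp: saturated_def colours_def)
  then consider "u = v" | "w = v"
    using saturated_avoids[OF assms(1)] by blast
  then show thesis
    using uw assms(2) that by cases auto
qed

lemma card_colours_delete:
  assumes "finite V"
  shows "card (colours d V) = card (colours d (V - {v})) + card (saturated d V v)"
proof -
  have "colours d (V - {v}) \<subseteq> colours d V"
    by (auto simp: colours_def)
  then show ?thesis
    unfolding saturated_def using finite_colours[OF assms, of d]
    by (metis card_Diff_subset card_mono finite_subset le_add_diff_inverse)
qed

lemma two_elements:
  assumes "2 \<le> card A"
  obtains x y where "x \<in> A" "y \<in> A" "x \<noteq> y"
proof -
  obtain B where "B \<subseteq> A" "card B = 2"
    using assms by (meson obtain_subset_with_card_n)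
  then show thesis
    using that by (auto simp: card_2_iff)
qed

text \<open>Two saturated colours at \<open>v\<close> would lie on edges \<open>va\<close> and
  \<open>vb\<close>, and \<open>ab\<close> can carry neither, giving a rainbow triangle. So each
  deleted vertex costs at most one colour, and a single vertex has none. The bound yields the
  rainbow triangle in \<open>card_colours_5\<close> and a colour count in
  \<open>no_twin_stars\<close>.\<close>

lemma card_colours_no_rainbow_triangle:
  fixes d :: "'a \<Rightarrow> 'a \<Rightarrow> 'b"
  assumes "finite V" "V \<noteq> {}" and sym: "\<And>u v. d u v = d v u"
    and "\<And>a b c. \<lbrakk>a \<in> V; b \<in> V; c \<in> V; distinct [a, b, c]\<rbrakk> \<Longrightarrow> \<not> distinct [d a b, d b c, d a c]"
  shows "card (colours d V) < card V"
  using assms(1,2,4)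
proof (induction "card V" arbitrary: V rule: less_induct)
  case less
  obtain v where v: "v \<in> V"
    using less.prems by blast
  have sat: "card (saturated d V v) \<le> 1"
  proof (rule ccontr)
    assume "\<not> ?thesis"
    then obtain x y where xy: "x \<in> saturated d V v" "y \<in> saturated d V v" "x \<noteq> y"
      using two_elements[of "saturated d V v"] by (metis not_less_eq_eq numeral_2_eq_2 One_nat_def)
    obtain a b where ab: "a \<in> V" "a \<noteq> v" "x = d v a" "b \<in> V" "b \<noteq> v" "y = d v b"
      using xy(1,2) sym by (metis saturated_edge)
    have "a \<noteq> b" using ab xy by auto
    then have "distinct [d v a, d a b, d v b]"
      using saturated_avoids[OF xy(1), of a b] saturated_avoids[OF xy(2), of a b] ab xy(3) by auto
    then show False
      using less.prems(3)[of v a b] ab v \<open>a \<noteq> b\<close> by auto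
  qed
  show ?case
  proof (cases "V = {v}")
    case True
    then show ?thesis by (auto simp: colours_def)
  next
    case False
    have "card (colours d (V - {v})) < card (V - {v})"
      by (rule less.hyps) (use less.prems False v in \<open>auto simp: card_gt_0_iff\<close>)
    then show ?thesis
      using sat v less.prems(1) card_colours_delete[of V d v] by simp
  qed
qed

section \<open>Colourings without a rainbow bull\<close>

locale bull_free =
  fixes d :: "'a \<Rightarrow> 'a \<Rightarrow> 'b" and V :: "'a set"
  assumes finV: "finite V"
    and sym: "d u v = d v u"
    and no_bull: "\<lbrakk>{a, b, c, e, f} \<subseteq> V; distinct [a, b, c, e, f]\<rbrakk> \<Longrightarrow>
      \<not> distinct [d a b, d b c, d a c, d a e, d b f]"
begin

text \<open>Otherwise the triangle with both pendant edges would be a rainbow bull. This is the form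
  in which the absence of bulls is mostly used.\<close>

lemma pendants:
  assumes "{a, b, c, e, f} \<subseteq> V" "distinct [a, b, c, e, f]" "distinct [d a b, d b c, d a c]"
    and "d a e \<notin> {d a b, d b c, d a c}" "d b f \<notin> {d a b, d b c, d a c}"
  shows "d a e = d b f"
  using no_bull[OF assms(1,2)] assms(3-5) by auto

text \<open>Take a triangle through \<open>a\<close> in the \<open>K4\<close>, the pendant edge
  \<open>ay\<close>, and a pendant edge to the fourth vertex: \<open>ay\<close> must repeat a colour
  of the triangle. The three triangles through \<open>a\<close> have no common colour.\<close>

lemma no_rainbow_K4:
  assumes V: "{a, b, c, x, y} \<subseteq> V" "distinct [a, b, c, x, y]"
  shows "\<not> distinct [d a b, d b c, d a c, d a x, d b x, d c x]"
proof
  assume *: "distinct [d a b, d b c, d a c, d a x, d b x, d c x]"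
  have 1: "d a y \<in> {d a b, d b c, d a c}"
    using no_bull[of a b c y x] no_bull[of a c b y x] V * sym by auto
  have 2: "d a y \<in> {d a b, d b x, d a x}"
    using no_bull[of a b x y c] no_bull[of a x b y c] V * sym by auto
  have 3: "d a y \<in> {d a c, d c x, d a x}"
    using no_bull[of a c x y b] no_bull[of a x c y b] V * sym by auto
  show False using 1 2 3 * by auto
qed

text \<open>Bulls that use \<open>bx\<close> as a pendant edge of either triangle leave only the
  colours of \<open>ac\<close> and \<open>ay\<close> for it; in both cases a triangle on
  \<open>a\<close>, \<open>b\<close>, \<open>x\<close> extends to a rainbow bull.\<close>

lemma no_rainbow_bowtie:
  assumes V: "{a, b, c, x, y} \<subseteq> V" "distinct [a, b, c, x, y]"
  shows "\<not> distinct [d a b, d b c, d a c, d a x, d a y, d x y]"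
proof
  assume *: "distinct [d a b, d b c, d a c, d a x, d a y, d x y]"
  have 1: "d b x \<in> {d a b, d b c, d a c, d a y}"
    using no_bull[of a b c y x] V * by auto
  have 2: "d b x \<in> {d a x, d a y, d x y, d a c}"
    using no_bull[of a x y c b] V * sym by auto
  have 3: "d b x = d a c \<Longrightarrow> False"
    using no_bull[of a b x y c] V * sym by auto
  have 4: "d b x = d a y \<Longrightarrow> False"
    using no_bull[of a x b c y] V * sym by auto
  show False using 1 2 3 4 * by auto
qed

text \<open>The triangle \<open>abx\<close> with the pendant edges \<open>ac\<close> and
  \<open>xy\<close> is a bull.\<close>

lemma no_rainbow_fan:
  assumes V: "{a, b, c, x, y} \<subseteq> V" "distinct [a, b, c, x, y]"
  shows "\<not> distinct [d a b, d b c, d a c, d a x, d b x, d x y]"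
  using no_bull[of a x b c y] V sym by auto

lemma card_colours_5:
  assumes "card V = 5"
  shows "card (colours d V) \<le> 5"
proof (rule ccontr)
  assume many: "\<not> ?thesis"
  then have "\<not> card (colours d V) < card V" using assms by simp
  then obtain a b c where abc: "a \<in> V" "b \<in> V" "c \<in> V" "distinct [a, b, c]"
    and tri: "distinct [d a b, d b c, d a c]"
    using card_colours_no_rainbow_triangle[of V d] finV sym assms by (metis card.empty zero_neq_numeral)
  have "card (V - {a, b, c}) = 2"
    using abc assms finV by (subst card_Diff_subset) auto
  then obtain x y where xy: "V - {a, b, c} = {x, y}" "x \<noteq> y"
    by (auto simp: card_2_iff)
  have V: "V = {a, b, c, x, y}" using xy abc by auto
  have D: "distinct [a, b, c, x, y]" using xy abc by auto
  define T where "T = {d a b, d b c, d a c}"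
  have "card T = 3" using tri by (auto simp: T_def)
  have TC: "T \<subseteq> colours d V" using abc by (auto simp: T_def intro!: coloursI)
  have "3 \<le> card (colours d V - T)"
    using many \<open>card T = 3\<close> card_Diff_subset[OF _ TC] by (simp add: T_def)
  then obtain B where B: "B \<subseteq> colours d V - T" "card B = 3"
    by (meson obtain_subset_with_card_n)
  then obtain i j k where ijk: "i \<in> colours d V - T" "j \<in> colours d V - T" "k \<in> colours d V - T"
      "i \<noteq> j" "i \<noteq> k" "j \<noteq> k"
    by (auto simp: card_3_iff)
  \<comment> \<open>Some three of the seven edges not in the triangle have distinct colours outside \<open>T\<close>; the
    constraints \<open>p\<close> to \<open>s\<close> below leave no room for them.\<close>
  let ?N = "{d a x, d b x, d c x, d a y, d b y, d c y, d x y}"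
  have N: "colours d V - T \<subseteq> ?N"
    unfolding colours_def V T_def using sym by auto
  have rainbow: "distinct [d u v, d v w, d u w]" if "T = {d u v, d v w, d u w}" for u v w
    using \<open>card T = 3\<close> that by (intro card_distinct) simp
  have P: "d u g \<in> T \<or> d v h \<in> T \<or> d u g = d v h"
    if "T = {d u v, d v w, d u w}" "{u, v, w, g, h} \<subseteq> V" "distinct [u, v, w, g, h]" for u v w g h
    using pendants[OF that(2,3) rainbow[OF that(1)]] unfolding that(1) by blast
  have Q: "d u g \<in> T \<or> d v g \<in> T \<or> d w g \<in> T \<or> \<not> distinct [d u g, d v g, d w g]"
    if "T = {d u v, d v w, d u w}" "{u, v, w, g, h} \<subseteq> V" "distinct [u, v, w, g, h]" for u v w g h
    using no_rainbow_K4[OF that(2,3)] rainbow[OF that(1)] unfolding that(1) by auto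
  have R: "d u g \<in> T \<or> d u h \<in> T \<or> d g h \<in> T \<or> \<not> distinct [d u g, d u h, d g h]"
    if "T = {d u v, d v w, d u w}" "{u, v, w, g, h} \<subseteq> V" "distinct [u, v, w, g, h]" for u v w g h
    using no_rainbow_bowtie[OF that(2,3)] rainbow[OF that(1)] unfolding that(1) by auto
  have S: "d u g \<in> T \<or> d v g \<in> T \<or> d g h \<in> T \<or> \<not> distinct [d u g, d v g, d g h]"
    if "T = {d u v, d v w, d u w}" "{u, v, w, g, h} \<subseteq> V" "distinct [u, v, w, g, h]" for u v w g h
    using no_rainbow_fan[OF that(2,3)] rainbow[OF that(1)] unfolding that(1) by auto
  have T: "T = {d a b, d b c, d a c}" "T = {d b c, d c a, d b a}" "T = {d c a, d a b, d c b}"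
    using sym[of a b] sym[of a c] sym[of b c] by (auto simp: T_def)
  have p: "d a x \<in> T \<or> d b y \<in> T \<or> d a x = d b y"
    "d b y \<in> T \<or> d c x \<in> T \<or> d b y = d c x"
    "d c x \<in> T \<or> d a y \<in> T \<or> d c x = d a y"
    "d a y \<in> T \<or> d b x \<in> T \<or> d a y = d b x"
    "d b x \<in> T \<or> d c y \<in> T \<or> d b x = d c y"
    "d c y \<in> T \<or> d a x \<in> T \<or> d c y = d a x"
    by (rule P[OF T(1)] P[OF T(2)] P[OF T(3)]; use V D in auto)+
  have q: "d a x \<in> T \<or> d b x \<in> T \<or> d c x \<in> T \<or> \<not> distinct [d a x, d b x, d c x]"
    "d a y \<in> T \<or> d b y \<in> T \<or> d c y \<in> T \<or> \<not> distinct [d a y, d b y, d c y]"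
    using Q[OF T(1), of x y] Q[OF T(1), of y x] V D by auto
  have r: "d a x \<in> T \<or> d a y \<in> T \<or> d x y \<in> T \<or> \<not> distinct [d a x, d a y, d x y]"
    "d b x \<in> T \<or> d b y \<in> T \<or> d x y \<in> T \<or> \<not> distinct [d b x, d b y, d x y]"
    "d c x \<in> T \<or> d c y \<in> T \<or> d x y \<in> T \<or> \<not> distinct [d c x, d c y, d x y]"
    by (rule R[OF T(1)] R[OF T(2)] R[OF T(3)]; use V D in auto)+
  have s: "d a x \<in> T \<or> d b x \<in> T \<or> d x y \<in> T \<or> \<not> distinct [d a x, d b x, d x y]"
    "d b x \<in> T \<or> d c x \<in> T \<or> d x y \<in> T \<or> \<not> distinct [d b x, d c x, d x y]"
    "d c x \<in> T \<or> d a x \<in> T \<or> d x y \<in> T \<or> \<not> distinct [d c x, d a x, d x y]"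
    "d a y \<in> T \<or> d b y \<in> T \<or> d y x \<in> T \<or> \<not> distinct [d a y, d b y, d y x]"
    "d b y \<in> T \<or> d c y \<in> T \<or> d y x \<in> T \<or> \<not> distinct [d b y, d c y, d y x]"
    "d c y \<in> T \<or> d a y \<in> T \<or> d y x \<in> T \<or> \<not> distinct [d c y, d a y, d y x]"
    by (rule S[OF T(1)] S[OF T(2)] S[OF T(3)]; use V D in auto)+
  \<comment> \<open>Arrange the edges between triangle and \<open>{x, y}\<close> cyclically as
    \<open>ax\<close>, \<open>by\<close>, \<open>cx\<close>, \<open>ay\<close>, \<open>bx\<close>,
    \<open>cy\<close>. By \<open>p\<close>, neighbours with colours outside \<open>T\<close> agree,
    so three new colours on this hexagon sit on alternate edges, against \<open>q\<close>. Two of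
    them together with \<open>xy\<close> sit on opposite edges, against \<open>r\<close>, or on
    edges at distance two, against \<open>s\<close>.\<close>
  have "i \<in> ?N" "j \<in> ?N" "k \<in> ?N" "i \<notin> T" "j \<notin> T" "k \<notin> T" using ijk N by auto
  then show False
    using p q r s[unfolded sym[of y x]] ijk(4-6) unfolding distinct.simps list.set insert_iff empty_iff by (smt (verit))
qed

end

section \<open>Colourings in which every vertex has two saturated colours\<close>

locale critical_bull_free = bull_free +
  assumes card_ge_6: "6 \<le> card V"
    and many_colours: "card V + 1 < card (colours d V)"
    and two_saturated: "v \<in> V \<Longrightarrow> 2 \<le> card (saturated d V v)"
begin

abbreviation "sat \<equiv> saturated d V"

lemma fresh:
  assumes "length xs \<le> 5"
  obtains e where "e \<in> V" "e \<notin> set xs"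
proof -
  have "card (set xs) < card V"
    using assms card_length[of xs] card_ge_6 by linarith
  then have "\<not> V \<subseteq> set xs"
    using card_mono[of "set xs" V] by auto
  then show thesis using that by blast
qed

lemma avoids: "\<lbrakk>d p q \<in> sat v; u \<in> V; w \<in> V; u \<noteq> w; u \<noteq> v; w \<noteq> v\<rbrakk> \<Longrightarrow> d u w \<noteq> d p q"
  by (rule saturated_avoids)

lemma another_saturated:
  assumes "v \<in> V"
  obtains a where "a \<in> V" "a \<noteq> v" "d v a \<in> sat v" "d v a \<noteq> x"
proof -
  obtain y z where "y \<in> sat v" "z \<in> sat v" "y \<noteq> z"
    using two_elements[OF two_saturated[OF assms]] by blast
  then obtain y where "y \<in> sat v" "y \<noteq> x" by metis
  then show thesis
    using that sym by (metis saturated_edge)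
qed

text \<open>In the rainbow triangle \<open>vab\<close> the third saturated edge \<open>vc\<close> is
  a pendant edge at \<open>v\<close>, which forces every edge from \<open>a\<close> to a vertex
  other than \<open>b\<close>, \<open>c\<close>, \<open>v\<close> to have the colour of
  \<open>ab\<close>. Permuting the roles, all edges at \<open>a\<close> except \<open>av\<close>
  share a colour that also occurs away from \<open>a\<close>, so \<open>a\<close> has no second
  saturated colour.\<close>

lemma no_three_saturated:
  assumes V: "{v, a, b, c} \<subseteq> V" "distinct [v, a, b, c]"
    and sat: "d v a \<in> sat v" "d v b \<in> sat v" "d v c \<in> sat v"
    and dist: "distinct [d v a, d v b, d v c]"
  shows False
proof -
  obtain e where e: "e \<in> V" "e \<notin> set [v, a, b, c]"
    by (rule fresh[of "[v, a, b, c]"]) auto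
  have eq: "d p f = d p q"
    if "{v, p, q, r, f} \<subseteq> V" "distinct [v, p, q, r, f]"
      "d v p \<in> sat v" "d v q \<in> sat v" "d v r \<in> sat v" "distinct [d v p, d v q, d v r]" for p q r f
  proof (rule ccontr)
    assume "d p f \<noteq> d p q"
    then show False
      using pendants[of v p q r f] avoids[of v p v p f] avoids[of v q v p f] avoids[of v r v p f]
        avoids[of v p v p q] avoids[of v q v p q] avoids[of v r v p q] that by auto
  qed
  have "d a f = d b e" if f: "f \<in> V" "f \<noteq> a" "f \<noteq> v" for f
    using eq[of a b c e] eq[of a c b e] eq[of b a c e] eq[of a b c f] sym
      V e f sat dist by (cases "f \<in> {b, c}") auto
  moreover obtain f where f: "f \<in> V" "f \<noteq> a" "d a f \<in> sat a" "d a f \<noteq> d a v"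
    using another_saturated[of a] V by auto
  ultimately have "d a f = d b e" by metis
  then show False
    using avoids[OF f(3), of b e] V e by auto
qed

lemma card_saturated:
  assumes "v \<in> V"
  shows "card (sat v) = 2"
proof (rule ccontr)
  assume "card (sat v) \<noteq> 2"
  then have "3 \<le> card (sat v)" using two_saturated[OF assms] by simp
  then obtain B where "B \<subseteq> sat v" "card B = 3"
    by (meson obtain_subset_with_card_n)
  then obtain x y z where xyz: "x \<in> sat v" "y \<in> sat v" "z \<in> sat v" "distinct [x, y, z]"
    by (auto simp: card_3_iff)
  then obtain a b c where "a \<in> V" "a \<noteq> v" "x = d v a" "b \<in> V" "b \<noteq> v" "y = d v b"
      "c \<in> V" "c \<noteq> v" "z = d v c"
    using sym by (metis saturated_edge)
  then show False
    using no_three_saturated[of v a b c] xyz assms by auto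
qed

text \<open>A rainbow triangle in the rest, with pendant edges to \<open>b\<close> and
  \<open>v\<close>, would be a rainbow bull. So the rest has at most \<open>card V - 3\<close>
  colours, and only three more can occur elsewhere.\<close>

lemma no_twin_stars:
  assumes V: "{b, v} \<subseteq> V" "b \<noteq> v"
    and star: "\<And>e. e \<in> V - {b, v} \<Longrightarrow> d b e = r" "\<And>e. e \<in> V - {b, v} \<Longrightarrow> d v e = p"
    and sat: "r \<in> sat b" "p \<in> sat v" and "p \<noteq> r"
  shows False
proof -
  let ?W = "V - {b, v}"
  have W: "card ?W = card V - 2" "finite ?W"
    using V finV by (auto simp: card_Diff_subset)
  have "card (colours d ?W) < card ?W"
  proof (rule card_colours_no_rainbow_triangle)
    show "?W \<noteq> {}" using W card_ge_6 by (metis One_nat_def card.empty diff_is_0_eq not_numeral_le_zero numeral_le_iff semiring_norm le_trans)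
    fix x y z assume *: "x \<in> ?W" "y \<in> ?W" "z \<in> ?W" "distinct [x, y, z]"
    have "d x b = r" "d y v = p"
      using star(1)[of x] star(2)[of y] * sym[of x b] sym[of y v] by auto
    moreover have "r \<notin> {d x y, d y z, d x z}" "p \<notin> {d x y, d y z, d x z}"
      using saturated_avoids[OF sat(1)] saturated_avoids[OF sat(2)] * by auto
    ultimately show "\<not> distinct [d x y, d y z, d x z]"
      using pendants[of x y z b v] * V \<open>p \<noteq> r\<close> by auto
  qed (use W sym in auto)
  moreover have "colours d V \<subseteq> {p, r, d b v} \<union> colours d ?W"
  proof
    fix k assume "k \<in> colours d V"
    then obtain u w where "k = d u w" "u \<in> V" "w \<in> V" "u \<noteq> w"
      by (auto simp: colours_def)
    then show "k \<in> {p, r, d b v} \<union> colours d ?W"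
      using star[of u] star[of w] sym[of u w] coloursI[of u ?W w d]
      by (cases "u \<in> {b, v}"; cases "w \<in> {b, v}") auto
  qed
  then have "card (colours d V) \<le> card ({p, r, d b v} \<union> colours d ?W)"
    by (rule card_mono[rotated]) (use finite_colours[OF W(2)] in simp)
  moreover have "card ({p, r, d b v} \<union> colours d ?W) \<le> card {p, r, d b v} + card (colours d ?W)"
    by (rule card_Un_le)
  moreover have "card {p, r, d b v} \<le> 3"
    using card_length[of "[p, r, d b v]"] by simp
  ultimately show False
    using many_colours W card_ge_6 by linarith
qed

text \<open>If no such path exists, the edges with colours saturated at \<open>v\<close> lie on a triangle of
  the extremal colouring; otherwise \<open>b\<close>, \<open>v\<close>, \<open>a\<close>, \<open>c\<close> turns out to be one of its 4-cycles.\<close>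

definition saturated_path :: "'a \<Rightarrow> 'a \<Rightarrow> 'a \<Rightarrow> 'a \<Rightarrow> bool" where
  "saturated_path b v a c \<longleftrightarrow> {b, v, a, c} \<subseteq> V \<and> distinct [v, a, b, c] \<and>
     d v a \<in> sat v \<and> d v b \<in> sat v \<and> d v a \<noteq> d v b \<and>
     d a c \<in> sat a \<and> d a c \<noteq> d v a \<and> d a c \<noteq> d a b"

text \<open>The triangle \<open>vab\<close> is rainbow and \<open>ac\<close> is a pendant edge with
  a fourth colour; a pendant edge at \<open>b\<close> or \<open>v\<close> cannot have that colour,
  as it is saturated at \<open>a\<close>, so it repeats a colour of the triangle.\<close>

lemma path_outside:
  assumes P: "saturated_path b v a c" and e: "e \<in> V" "e \<notin> {v, a, b, c}"
  shows "d b e = d a b" "d v e \<in> {d v a, d v b, d a b}"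
proof -
  note P = P[unfolded saturated_path_def]
  have 1: "d a b \<noteq> d v a" "d a b \<noteq> d v b" "d b e \<noteq> d v a" "d b e \<noteq> d v b" "d a c \<noteq> d v b"
    using avoids[of v a v a b] avoids[of v b v a b] avoids[of v a v b e] avoids[of v b v b e]
      avoids[of v b v a c] P e by auto
  have 2: "d b e \<noteq> d a c" "d v e \<noteq> d a c"
    using avoids[of a c a b e] avoids[of a c a v e] P e by auto
  show "d b e = d a b"
  proof (rule ccontr)
    assume "d b e \<noteq> d a b"
    then show False using pendants[of a b v c e] P e 1 2 sym by auto
  qed
  show "d v e \<in> {d v a, d v b, d a b}"
    using pendants[of a v b c e] P e 1 2 sym by auto
qed

lemma path_middle:
  assumes P: "saturated_path b v a c"
  shows "d v a \<in> sat a"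
proof (rule ccontr)
  assume contr: "d v a \<notin> sat a"
  note P' = P[unfolded saturated_path_def]
  obtain e where e: "e \<in> V" "e \<noteq> a" "d a e \<in> sat a" "d a e \<noteq> d a c"
    using another_saturated[of a] P' by auto
  obtain f where f: "f \<in> V" "f \<notin> set [v, a, b, c]"
    by (rule fresh[of "[v, a, b, c]"]) auto
  have "d b f = d a b" using path_outside(1)[OF P, of f] f by simp
  then have "d a b \<notin> sat a" using avoids[of a b a b f] f P' by auto
  then have "e \<noteq> b" "e \<noteq> v" "e \<noteq> c" and ne: "d a e \<noteq> d a b" "d a e \<noteq> d v a"
    using e contr sym by metis+
  \<comment> \<open>With two possible ends \<open>c\<close> and \<open>e\<close>,
    \<open>path_outside\<close> covers every vertex other than \<open>v\<close>, \<open>a\<close>,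
    \<open>b\<close>. This makes \<open>b\<close> and \<open>v\<close> the centres of twin
    stars.\<close>
  then have P2: "saturated_path b v a e" using P' e unfolding saturated_path_def by auto
  have b: "d b g = d a b" and v: "d v g \<in> {d v a, d v b, d a b}" if "g \<in> V - {v, a, b}" for g
    using path_outside[OF P, of g] path_outside[OF P2, of g] that e by (cases "g = c"; auto)+
  have b': "d b g \<in> {d v b, d a b}" if "g \<in> V" "g \<noteq> b" for g
    using b[of g] that sym by auto
  \<comment> \<open>A recurring device: when only two colours are candidates for saturation,
    avoiding each in turn shows that both are saturated.\<close>
  obtain g h where "g \<in> V" "g \<noteq> b" "d b g \<in> sat b" "d b g \<noteq> d a b"
      "h \<in> V" "h \<noteq> b" "d b h \<in> sat b" "d b h \<noteq> d v b"
    using another_saturated[of b] P' by (metis insert_subset)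
  then have sb: "d v b \<in> sat b" "d a b \<in> sat b" using b'[of g] b'[of h] by auto
  have vg: "d v g = d v a" if g: "g \<in> V - {b, v}" for g
    using v[of g] avoids[OF sb(1), of v g] avoids[OF sb(2), of v g] g P' by (cases "g = a") auto
  have bg: "d b g = d a b" if g: "g \<in> V - {b, v}" for g
    using b[of g] g sym by (cases "g = a") auto
  have "d v a \<noteq> d a b" using avoids[of v a v a b] P' by auto
  then show False
    using no_twin_stars[of b v "d a b" "d v a"] vg bg sb P' by auto
qed

text \<open>If the colours agreed, \<open>vac\<close> would be a rainbow triangle. Its pendant edges
  at \<open>c\<close> leave only the colours of \<open>ac\<close> and \<open>cb\<close> to be
  saturated at \<open>c\<close>; then \<open>cb\<close> and an edge from \<open>a\<close> to an
  outside vertex complete a rainbow bull.\<close>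

lemma path_chord_ne:
  assumes P: "saturated_path b v a c"
  shows "d v c \<noteq> d v b"
proof
  assume eq: "d v c = d v b"
  note P' = P[unfolded saturated_path_def]
  have sa: "d v a \<in> sat a" using path_middle[OF P] .
  have n1: "d a c \<noteq> d v b" "d a b \<noteq> d v a" "d a b \<noteq> d v b"
    using avoids[of v b v a c] avoids[of v a v a b] avoids[of v b v a b] P' by auto
  have cf: "d c f \<notin> {d v a, d a c, d v b}" if f: "f \<in> V" "f \<notin> {a, v, c}" for f
    using avoids[of v a v c f] avoids[of v b v c f] avoids[of a c a c f] P' f by auto
  have cr: "d c f = d a b" if f: "f \<in> V" "f \<notin> {a, v, c, b}" for f
    using pendants[of a c v b f] cf[of f] P' f n1 eq sym by auto
  have "d v b \<notin> sat c" "d a b \<notin> sat c"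
    using avoids[of v b c v b] avoids[of a b c a b] P' by auto
  then have sc: "d c g \<in> {d a c, d c b}" if "d c g \<in> sat c" "g \<in> V" "g \<noteq> c" for g
    using cr[of g] that eq sym P' by (cases "g \<in> {a, v, b}") auto
  obtain g h where "g \<in> V" "g \<noteq> c" "d c g \<in> sat c" "d c g \<noteq> d c b"
      "h \<in> V" "h \<noteq> c" "d c h \<in> sat c" "d c h \<noteq> d a c"
    using another_saturated[of c] P' by (metis insert_subset)
  then have s2: "d a c \<in> sat c" "d c b \<in> sat c" using sc[of g] sc[of h] by auto
  obtain e where e: "e \<in> V" "e \<notin> set [v, a, b, c]"
    by (rule fresh[of "[v, a, b, c]"]) auto
  have "d a e \<noteq> d v a" "d a e \<noteq> d v b" "d a e \<noteq> d a c" "d a e \<noteq> d c b"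
    using avoids[of v a v a e] avoids[of v b v a e] avoids[of a c c a e] avoids[of c b c a e]
      P' e s2 by auto
  then show False
    using pendants[of a c v e b] cf[of b] P' e n1 eq sym by auto
qed

text \<open>This makes \<open>path_outside\<close> available from both ends of the path.\<close>

lemma path_reverse:
  assumes P: "saturated_path b v a c"
  shows "saturated_path c a v b"
  using P path_middle[OF P] path_chord_ne[OF P] sym
  unfolding saturated_path_def by auto

text \<open>If the chords differed, a triangle of outside vertices would have pendant edges to
  \<open>b\<close> and \<open>c\<close> in two different colours. Avoiding a rainbow bull then
  produces a second saturated path outside the first, and \<open>path_outside\<close> for it equates
  the two chord colours.\<close>

lemma path_chords_eq:
  assumes P: "saturated_path b v a c"
  shows "d v c = d a b"
proof (rule ccontr)
  assume ne: "d v c \<noteq> d a b"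
  note P' = P[unfolded saturated_path_def]
  note R = path_reverse[OF P]
  \<comment> \<open>Edges from an outside vertex \<open>e\<close> to the path repeat colours of
    edges within the path, so they are not saturated at \<open>e\<close>.\<close>
  have out: "g \<notin> {v, a, b, c}" if e: "e \<in> V" "e \<notin> {v, a, b, c}" and g: "d e g \<in> sat e" for e g
    using path_outside[OF P e] path_outside[OF R, of e] e g P' sym
      avoids[of _ _ e v a] avoids[of _ _ e v b] avoids[of _ _ e v c] avoids[of _ _ e a b]
      avoids[of _ _ e a c]
    by (smt (verit) insert_iff insert_subset singletonD distinct.simps(2) list.set)
  obtain e where e: "e \<in> V" "e \<notin> set [v, a, b, c]"
    by (rule fresh[of "[v, a, b, c]"]) auto
  obtain f where f: "f \<in> V" "f \<noteq> e" "d e f \<in> sat e"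
    using another_saturated[of e] e by metis
  obtain g where g: "g \<in> V" "g \<noteq> e" "d e g \<in> sat e" "d e g \<noteq> d e f"
    using another_saturated[of e] e by auto
  have fo: "f \<notin> {v, a, b, c}" and go: "g \<notin> {v, a, b, c}"
    using out[of e f] out[of e g] e f g by auto
  have "f \<noteq> g" using g by auto
  have fg: "d f g \<noteq> d e f" "d f g \<noteq> d e g"
    using avoids[OF f(3), of f g] avoids[OF g(3), of f g] f g \<open>f \<noteq> g\<close> by auto
  have out_b: "d h b = d a b" and out_c: "d h c = d v c" if "h \<in> V" "h \<notin> {v, a, b, c}" for h
    using path_outside(1)[OF P, of h] path_outside(1)[OF R, of h] that sym by auto
  have uv: "d a b \<noteq> d e f" "d a b \<noteq> d e g" "d v c \<noteq> d e f" "d v c \<noteq> d e g"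
    using avoids[OF f(3), of a b] avoids[OF g(3), of a b] avoids[OF f(3), of v c]
      avoids[OF g(3), of v c] e P' by auto
  have t: "d f g = d a b \<or> d f g = d v c"
  proof (rule ccontr)
    assume "\<not> ?thesis"
    then show False
      using pendants[of e f g b c] out_b[of e] out_c[of f] e f g fo go P' fg uv ne \<open>f \<noteq> g\<close>
      by auto
  qed
  obtain h where h: "h \<in> V" "h \<noteq> f" "d f h \<in> sat f" "d f h \<noteq> d f e"
    using another_saturated[of f] f by auto
  have ho: "h \<notin> {v, a, b, c}" using out[of f h] f fo h by auto
  have "d f h \<noteq> d f g"
    using t avoids[OF h(3), of a b] avoids[OF h(3), of v c] fo P' by auto
  then have "saturated_path g e f h"
    unfolding saturated_path_def using e f g h \<open>f \<noteq> g\<close> sym by auto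
  from path_outside(1)[OF this, of b] path_outside(1)[OF this, of c]
  have "d g b = d f g" "d g c = d f g" using e fo go ho P' by auto
  then show False using out_b[of g] out_c[of g] go g ne by auto
qed

text \<open>For distinct vertices of \<open>V\<close>, a colour saturated at both ends occurs on
  that one edge only.\<close>

definition single :: "'a \<Rightarrow> 'a \<Rightarrow> bool" where
  "single u v \<longleftrightarrow> d u v \<in> sat u \<and> d u v \<in> sat v"

lemma single_sym: "single u v \<longleftrightarrow> single v u"
  using sym by (auto simp: single_def)

text \<open>The chord \<open>vc\<close> repeats the colour of \<open>ab\<close>, which is therefore
  not saturated at \<open>b\<close>; this leaves \<open>vb\<close> as a saturated edge there. As
  \<open>va\<close> and \<open>vb\<close> are now single, \<open>path_outside\<close> leaves one
  colour for the other edges at \<open>v\<close>.\<close>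

lemma path_star:
  assumes P: "saturated_path b v a c"
  shows "single v a" "single v b" "\<And>e. e \<in> V - {v, a, b} \<Longrightarrow> d v e = d a b"
proof -
  note P' = P[unfolded saturated_path_def]
  have sa: "d v a \<in> sat a" using path_middle[OF P] .
  then show "single v a" using P' by (simp add: single_def)
  have vc: "d v c = d a b" using path_chords_eq[OF P] .
  then have r: "d a b \<notin> sat b" using avoids[of a b b v c] P' by auto
  obtain g where g: "g \<in> V" "g \<noteq> b" "d b g \<in> sat b" "d b g \<noteq> d b c"
    using another_saturated[of b] P' by auto
  then have "g = v"
    using path_outside(1)[OF P, of g] r sym[of a b] by (cases "g \<in> {v, a, c}") auto
  then have sb: "d v b \<in> sat b" using g sym by metis
  then show "single v b" using P' by (simp add: single_def)
  show "d v e = d a b" if "e \<in> V - {v, a, b}" for e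
    using path_outside(2)[OF P, of e] avoids[OF sa, of v e] avoids[OF sb, of v e] vc that P'
    by (cases "e = c") auto
qed

text \<open>Without saturated paths, only the colours of the triangle \<open>vab\<close> can be
  saturated at \<open>a\<close> and \<open>b\<close>, so all its edges are single. Pendant edges to
  two different outside vertices must then agree.\<close>

lemma triangle_star:
  assumes V: "{v, a, b} \<subseteq> V" "distinct [v, a, b]"
    and sv: "d v a \<in> sat v" "d v b \<in> sat v" "d v a \<noteq> d v b"
    and na: "\<And>c. \<not> saturated_path b v a c" and nb: "\<And>c. \<not> saturated_path a v b c"
  shows "single v a" "single v b" "\<exists>w. \<forall>e\<in>V - {v, a, b}. d v e = w"
proof -
  have only_a: "d a c \<in> {d v a, d a b}" if "c \<in> V" "c \<noteq> a" "d a c \<in> sat a" for c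
    using na[of c] that V sv sym unfolding saturated_path_def by auto
  have only_b: "d b c \<in> {d v b, d a b}" if "c \<in> V" "c \<noteq> b" "d b c \<in> sat b" for c
    using nb[of c] that V sv sym unfolding saturated_path_def by auto
  obtain g h where "g \<in> V" "g \<noteq> a" "d a g \<in> sat a" "d a g \<noteq> d v a"
      "h \<in> V" "h \<noteq> a" "d a h \<in> sat a" "d a h \<noteq> d a b"
    using another_saturated[of a] V by (metis insert_subset)
  then have sa: "d v a \<in> sat a" "d a b \<in> sat a" using only_a[of g] only_a[of h] by auto
  obtain g h where "g \<in> V" "g \<noteq> b" "d b g \<in> sat b" "d b g \<noteq> d v b"
      "h \<in> V" "h \<noteq> b" "d b h \<in> sat b" "d b h \<noteq> d a b"
    using another_saturated[of b] V by (metis insert_subset)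
  then have sb: "d v b \<in> sat b" "d a b \<in> sat b" using only_b[of g] only_b[of h] by auto
  show "single v a" "single v b" using sa sb sv by (auto simp: single_def)
  have tri: "distinct [d v a, d a b, d v b]"
    using avoids[of v a v a b] avoids[of v b v a b] V sv by auto
  have eq: "d v e = d a f" if ef: "e \<in> V - {v, a, b}" "f \<in> V - {v, a, b}" "e \<noteq> f" for e f
  proof -
    have "d v e \<notin> {d v a, d a b, d v b}" "d a f \<notin> {d v a, d a b, d v b}"
      using avoids[OF sa(1), of v e] avoids[OF sa(2), of v e] avoids[OF sb(1), of v e]
        avoids[OF sv(1), of a f] avoids[OF sb(2), of a f] avoids[OF sv(2), of a f] V ef by auto
    then show ?thesis using pendants[of v a b e f] tri V ef by auto
  qed
  have "d v e = d v e'" if "e \<in> V - {v, a, b}" "e' \<in> V - {v, a, b}" for e e'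
  proof -
    obtain f where "f \<in> V" "f \<notin> set [v, a, b, e, e']"
      by (rule fresh[of "[v, a, b, e, e']"]) auto
    then show ?thesis using eq[of e f] eq[of e' f] that by auto
  qed
  then show "\<exists>w. \<forall>e\<in>V - {v, a, b}. d v e = w" by metis
qed

section \<open>From the stars at single vertices to a bound on all colours\<close>

lemma star_structure:
  assumes v: "v \<in> V"
  obtains a b w where "a \<in> V" "b \<in> V" "\<And>e. \<lbrakk>e \<in> V; e \<noteq> v; single v e\<rbrakk> \<Longrightarrow> e \<in> {a, b}"
    "\<And>e. \<lbrakk>e \<in> V; e \<noteq> v; \<not> single v e\<rbrakk> \<Longrightarrow> d v e = w"
proof -
  obtain a where a: "a \<in> V" "a \<noteq> v" "d v a \<in> sat v"
    using another_saturated[OF v] by metis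
  obtain b where b: "b \<in> V" "b \<noteq> v" "d v b \<in> sat v" "d v b \<noteq> d v a"
    using another_saturated[OF v] by metis
  have "a \<noteq> b" using b by auto
  have "single v a \<and> single v b \<and> (\<exists>w. \<forall>e\<in>V - {v, a, b}. d v e = w)"
  proof (cases "\<exists>c. saturated_path b v a c \<or> saturated_path a v b c")
    case True
    then show ?thesis
      using path_star[of b v a] path_star[of a v b] by (metis insert_commute)
  next
    case False
    then show ?thesis
      using triangle_star[of v a b] a b v \<open>a \<noteq> b\<close> by auto
  qed
  then obtain w where s: "single v a" "single v b" and w: "\<And>e. e \<in> V - {v, a, b} \<Longrightarrow> d v e = w"
    by blast
  \<comment> \<open>A further vertex \<open>f\<close> repeats the colour of \<open>ve\<close> on
    \<open>vf\<close>, an edge that misses \<open>e\<close>.\<close>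
  have only: "\<not> single v e" if e: "e \<in> V - {v, a, b}" for e
  proof -
    obtain f where f: "f \<in> V" "f \<notin> set [v, a, b, e]"
      by (rule fresh[of "[v, a, b, e]"]) auto
    then have "d v f = d v e" using w e by auto
    then show ?thesis using avoids[of v e e v f] f e v by (auto simp: single_def)
  qed
  show thesis
  proof (rule that[of a b w])
    show "e \<in> {a, b}" if "e \<in> V" "e \<noteq> v" "single v e" for e
      using only[of e] that by blast
    show "d v e = w" if "e \<in> V" "e \<noteq> v" "\<not> single v e" for e
      using w[of e] s that by blast
  qed (use a b in auto)
qed

lemma contradiction: False
proof -
  have "\<forall>v\<in>V. \<exists>a b w. \<forall>e\<in>V - {v}. (single v e \<longrightarrow> e \<in> {a, b}) \<and> (\<not> single v e \<longrightarrow> d v e = w)"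
    by (metis star_structure Diff_iff singletonI)
  then obtain A B w where *: "\<And>v e. \<lbrakk>v \<in> V; e \<in> V; e \<noteq> v; single v e\<rbrakk> \<Longrightarrow> e \<in> {A v, B v}"
      "\<And>v e. \<lbrakk>v \<in> V; e \<in> V; e \<noteq> v; \<not> single v e\<rbrakk> \<Longrightarrow> d v e = w v"
    by (metis (no_types, lifting) Diff_iff singletonD)
  have nonsingle: "w u = w v" if "u \<in> V" "v \<in> V" "u \<noteq> v" "\<not> single u v" for u v
    using *(2)[of u v] *(2)[of v u] that sym single_sym by metis
  have w_eq: "w u = w v" if uv: "u \<in> V" "v \<in> V" for u v
  proof (cases "u = v \<or> \<not> single u v")
    case True
    then show ?thesis using nonsingle uv by auto
  next
    case False
    then have "v \<in> {A u, B u}" using *(1)[of u v] uv by auto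
    \<comment> \<open>Here \<open>x\<close> is the other possible single neighbour of
      \<open>u\<close>. A vertex \<open>t\<close> joined to neither \<open>u\<close> nor
      \<open>v\<close> by a single edge then links their common colours.\<close>
    then obtain x where x: "{A u, B u} \<subseteq> {v, x}" by auto
    obtain t where t: "t \<in> V" "t \<notin> set [u, v, x, A v, B v]"
      by (rule fresh[of "[u, v, x, A v, B v]"]) auto
    then have "\<not> single u t" "\<not> single v t"
      using *(1)[of u t] *(1)[of v t] uv x by auto
    then show ?thesis using nonsingle[of u t] nonsingle[of v t] uv t by auto
  qed
  obtain v0 where v0: "v0 \<in> V" by (rule fresh[of "[]"]) auto
  let ?U = "colours d V - {w v0}"
  have finU: "finite ?U" using finite_colours[OF finV, of d] by simp
  \<comment> \<open>Double counting of pairs of a colour in \<open>?U\<close> and a vertex where it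
    is saturated: each such colour lies on a single edge and so has two vertices, while each vertex
    has two saturated colours.\<close>
  have two: "2 \<le> card {v \<in> V. x \<in> sat v}" if x: "x \<in> ?U" for x
  proof -
    obtain u v where uv: "x = d u v" "u \<in> V" "v \<in> V" "u \<noteq> v"
      using x by (auto simp: colours_def)
    then have "single u v" using *(2)[of u v] w_eq[of u v0] x v0 by auto
    then have "{u, v} \<subseteq> {v \<in> V. x \<in> sat v}" using uv by (auto simp: single_def)
    then have "card {u, v} \<le> card {v \<in> V. x \<in> sat v}"
      by (rule card_mono[rotated]) (use finV in simp)
    then show ?thesis using uv by simp
  qed
  have "2 * card ?U \<le> (\<Sum>x\<in>?U. card {v \<in> V. x \<in> sat v})"
    using sum_bounded_below[of ?U 2 "\<lambda>x. card {v \<in> V. x \<in> sat v}"] two by (simp add: mult.commute)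
  also have "\<dots> = (\<Sum>v\<in>V. card {x \<in> ?U. x \<in> sat v})"
    using sum.swap_restrict[OF finU finV, of "\<lambda>_ _. 1 :: nat" "\<lambda>x v. x \<in> sat v"]
    by (simp only: card_eq_sum)
  also have "\<dots> \<le> (\<Sum>v\<in>V. 2)"
  proof (rule sum_mono)
    fix v assume "v \<in> V"
    have "finite (sat v)" using finite_colours[OF finV, of d] by (simp add: saturated_def)
    then have "card {x \<in> ?U. x \<in> sat v} \<le> card (sat v)" by (rule card_mono) auto
    then show "card {x \<in> ?U. x \<in> sat v} \<le> 2" using card_saturated[OF \<open>v \<in> V\<close>] by simp
  qed
  finally have "card ?U \<le> card V" by simp
  moreover have "card (colours d V) \<le> card ?U + 1"
    using diff_card_le_card_Diff[of "{w v0}" "colours d V"] by simp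
  ultimately show False using many_colours by simp
qed

end

section \<open>Induction on the number of vertices\<close>

lemma card_colours_bull_free:
  assumes "bull_free d V" "6 \<le> card V"
  shows "card (colours d V) \<le> card V + 1"
  using assms
proof (induction "card V" arbitrary: V rule: less_induct)
  case less
  interpret bull_free d V by fact
  show ?case
  proof (rule ccontr)
    assume many: "\<not> ?thesis"
    have "\<not> critical_bull_free d V" using critical_bull_free.contradiction by blast
    then obtain v where v: "v \<in> V" "card (saturated d V v) \<le> 1"
      using many less.prems(2)
      by (force simp: critical_bull_free_def critical_bull_free_axioms_def bull_free_axioms)
    interpret D: bull_free d "V - {v}"
      by unfold_locales (use finV sym no_bull in auto)
    have c: "card (V - {v}) = card V - 1" using v finV by simp
    \<comment> \<open>Deleting \<open>v\<close> loses at most one colour, so this bound suffices. At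
      six vertices the five-vertex case gives even one colour less.\<close>
    have "card (colours d (V - {v})) \<le> card V"
    proof (cases "card V = 6")
      case True
      then show ?thesis using D.card_colours_5 c by simp
    next
      case False
      then show ?thesis
        using less.hyps[of "V - {v}"] D.bull_free_axioms c less.prems(2) by simp
    qed
    then show False using card_colours_delete[OF finV, of d v] v many by simp
  qed
qed

section \<open>Rainbow copies of the bull\<close>

lemma edges_complete_graph:
  "edges (complete_graph n) = {{u, v} | u v. u < n \<and> v < n \<and> u \<noteq> v}"
  by (auto simp: complete_graph_def card_2_iff)

lemma image_edges_complete_graph:
  "c ` edges (complete_graph n) = colours (\<lambda>u v. c {u, v}) {..<n}"
  unfolding edges_complete_graph colours_def by auto

lemma has_rainbow_copy_bullI:
  assumes V: "{a, b, x, y, z} \<subseteq> {..<n}" "distinct [a, b, x, y, z]"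
    and c: "distinct [c {a, b}, c {b, x}, c {a, x}, c {a, y}, c {b, z}]"
  shows "has_rainbow_copy (complete_graph n) c bull"
proof -
  let ?E = "{{a, b}, {b, x}, {a, x}, {a, y}, {b, z}}"
  let ?S = "({a, b, x, y, z}, ?E)"
  let ?f = "\<lambda>v. if v = a then 0 else if v = b then 1 else if v = x then 2 else if v = y then 3 else 4 :: nat"
  have "subgraph ?S (complete_graph n)"
    using V by (auto simp: subgraph_def simple_graph_def complete_graph_def)
  moreover have "isomorphic ?S bull"
    unfolding isomorphic_def
  proof (intro exI[of _ ?f] conjI)
    show "bij_betw ?f (verts ?S) (verts bull)"
      using V by (auto simp: bij_betw_def inj_on_def bull_def)
    show "\<forall>u\<in>verts ?S. \<forall>v\<in>verts ?S. {u, v} \<in> edges ?S \<longleftrightarrow> {?f u, ?f v} \<in> edges bull"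
      using V by (auto simp: bull_def doubleton_eq_iff)
  qed
  moreover have "inj_on c (edges ?S)"
    using c by auto
  ultimately show ?thesis
    unfolding has_rainbow_copy_def by blast
qed

lemma has_rainbow_copy_bullE:
  assumes "has_rainbow_copy (complete_graph n) c bull"
  obtains a b x y z where "{a, b, x, y, z} \<subseteq> {..<n}" "distinct [a, b, x, y, z]"
    "distinct [c {a, b}, c {b, x}, c {a, x}, c {a, y}, c {b, z}]"
proof -
  obtain S f where S: "subgraph S (complete_graph n)" "inj_on c (edges S)"
    and f: "bij_betw f (verts S) (verts bull)"
    and iso: "\<And>u v. \<lbrakk>u \<in> verts S; v \<in> verts S\<rbrakk> \<Longrightarrow> {u, v} \<in> edges S \<longleftrightarrow> {f u, f v} \<in> edges bull"
    using assms unfolding has_rainbow_copy_def isomorphic_def by blast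
  have "\<exists>u \<in> verts S. f u = i" if "i \<in> {0, 1, 2, 3, 4}" for i
  proof -
    have "i \<in> f ` verts S" using bij_betw_imp_surj_on[OF f] that by (simp add: bull_def)
    then show ?thesis by blast
  qed
  then obtain a b x y z where v: "a \<in> verts S" "f a = 0" "b \<in> verts S" "f b = 1"
      "x \<in> verts S" "f x = 2" "y \<in> verts S" "f y = 3" "z \<in> verts S" "f z = 4"
    by (metis insertI1 insertI2)
  have e: "{a, b} \<in> edges S" "{b, x} \<in> edges S" "{a, x} \<in> edges S" "{a, y} \<in> edges S"
      "{b, z} \<in> edges S"
    using v by (simp_all add: iso bull_def)
  have D: "distinct [a, b, x, y, z]" using v by auto
  have "distinct (map c [{a, b}, {b, x}, {a, x}, {a, y}, {b, z}])"
    unfolding distinct_map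
  proof
    show "distinct [{a, b}, {b, x}, {a, x}, {a, y}, {b, z}]"
      using D by (auto simp: doubleton_eq_iff)
    show "inj_on c (set [{a, b}, {b, x}, {a, x}, {a, y}, {b, z}])"
      by (rule inj_on_subset[OF S(2)]) (use e in simp)
  qed
  moreover have "{a, b, x, y, z} \<subseteq> {..<n}"
    using v S(1) unfolding subgraph_def complete_graph_def by auto
  ultimately show thesis using that D by simp
qed

lemma rainbow_copy_bull:
  assumes "5 \<le> n" "(if n = 5 then 6 else n + 2) \<le> card (c ` edges (complete_graph n))"
  shows "has_rainbow_copy (complete_graph n) c bull"
proof (rule ccontr)
  assume no: "\<not> ?thesis"
  let ?d = "\<lambda>u v. c {u, v}"
  interpret bull_free ?d "{..<n}"
  proof
    show "c {u, v} = c {v, u}" for u v by (simp add: insert_commute)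
    show "\<not> distinct [c {a, b}, c {b, x}, c {a, x}, c {a, y}, c {b, z}]"
      if "{a, b, x, y, z} \<subseteq> {..<n}" "distinct [a, b, x, y, z]" for a b x y z
      using has_rainbow_copy_bullI[OF that] no by blast
  qed simp
  show False
    using card_colours_5 card_colours_bull_free[OF bull_free_axioms] assms
    unfolding image_edges_complete_graph by (cases "n = 5") auto
qed

section \<open>Colourings with many colours\<close>

text \<open>\<open>s\<close> rotates the components of a disjoint union of triangles, 4-cycles and isolated vertices
  on \<open>{..<n}\<close>, whose edges are the \<open>{i, s i}\<close> with \<open>s i \<noteq> i\<close>.\<close>

definition cycle_cover :: "nat \<Rightarrow> (nat \<Rightarrow> nat) \<Rightarrow> bool" where
  "cycle_cover n s \<longleftrightarrow> inj_on s {..<n} \<and>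
     (\<forall>i<n. s i < n \<and> (s i \<noteq> i \<longrightarrow> s (s i) \<noteq> i) \<and> (s (s (s i)) = i \<or> s (s (s (s i))) = i))"

lemma cycle_cover_append:
  assumes s: "cycle_cover n s" and t: "cycle_cover m t"
  shows "cycle_cover (n + m) (\<lambda>i. if i < n then s i else n + t (i - n))" (is "cycle_cover _ ?r")
proof -
  have lt: "?r i < n + m" if "i < n + m" for i
    using s t that unfolding cycle_cover_def by (auto simp: trans_less_add1)
  have "inj_on ?r {..<n + m}"
  proof (rule inj_onI)
    fix i j assume ij: "i \<in> {..<n + m}" "j \<in> {..<n + m}" "?r i = ?r j"
    have "s k < n" if "k < n" for k using s that unfolding cycle_cover_def by blast
    then have "i < n \<longleftrightarrow> j < n"
      using ij(3) by (metis not_add_less1)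
    moreover have "i - n < m \<and> j - n < m" if "\<not> i < n" "\<not> j < n"
      using ij that by auto
    ultimately show "i = j"
      using ij s t inj_onD[of s "{..<n}" i j] inj_onD[of t "{..<m}" "i - n" "j - n"]
      unfolding cycle_cover_def by (cases "i < n") auto
  qed
  moreover have "(?r i \<noteq> i \<longrightarrow> ?r (?r i) \<noteq> i) \<and> (?r (?r (?r i)) = i \<or> ?r (?r (?r (?r i))) = i)"
    if i: "i < n + m" for i
  proof (cases "i < n")
    case True
    then show ?thesis using s unfolding cycle_cover_def by auto
  next
    case False
    then obtain k where "i = n + k" "k < m"
      using i that[of "i - n"] by auto
    then show ?thesis using t unfolding cycle_cover_def by auto
  qed
  ultimately show ?thesis using lt unfolding cycle_cover_def by blast
qed

lemma cycle_cover_3: "cycle_cover 3 (\<lambda>i. Suc i mod 3)"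
proof -
  have "inj_on (\<lambda>i. Suc i mod 3) {..<3}"
    by (rule inj_onI) (auto simp: mod_Suc split: if_splits)
  moreover have "Suc (Suc i mod 3) mod 3 \<noteq> i" "Suc (Suc (Suc i mod 3) mod 3) mod 3 = i"
    if "i < 3" for i
    using that by (auto simp: mod_Suc split: if_splits)
  ultimately show ?thesis
    unfolding cycle_cover_def by simp
qed

lemma cycle_cover_4: "cycle_cover 4 (\<lambda>i. Suc i mod 4)"
proof -
  have "inj_on (\<lambda>i. Suc i mod 4) {..<4}"
    by (rule inj_onI) (auto simp: mod_Suc split: if_splits)
  moreover have "Suc (Suc i mod 4) mod 4 \<noteq> i" "Suc (Suc (Suc (Suc i mod 4) mod 4) mod 4) mod 4 = i"
    if "i < 4" for i
    using that by (auto simp: mod_Suc split: if_splits)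
  ultimately show ?thesis
    unfolding cycle_cover_def by simp
qed

text \<open>Every such \<open>n\<close> is a sum of threes and fours: 6, 7 and 8 directly, larger
  ones by adding 3.\<close>

lemma ex_cycle_cover:
  assumes "6 \<le> n"
  shows "\<exists>s. cycle_cover n s \<and> (\<forall>i<n. s i \<noteq> i)"
proof -
  let ?P = "\<lambda>n. \<exists>s. cycle_cover n s \<and> (\<forall>i<n. s i \<noteq> i)"
  have add: "?P (n + m)" if P: "?P n" "?P m" for n m
  proof -
    obtain s where s: "cycle_cover n s" "\<forall>i<n. s i \<noteq> i" using P(1) by blast
    obtain t where t: "cycle_cover m t" "\<forall>i<m. t i \<noteq> i" using P(2) by blast
    have "(if i < n then s i else n + t (i - n)) \<noteq> i" if i: "i < n + m" for i
    proof (cases "i < n")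
      case False
      then obtain k where "i = n + k" "k < m"
        using i that[of "i - n"] by auto
      then show ?thesis using t by simp
    qed (use s in simp)
    then show ?thesis using cycle_cover_append[OF s(1) t(1)] by blast
  qed
  have "Suc i mod 3 \<noteq> i" "Suc i mod 4 \<noteq> i" for i
    by presburger+
  then have 3: "?P 3" and 4: "?P 4"
    using cycle_cover_3 cycle_cover_4 by blast+
  from assms show ?thesis
  proof (induction n rule: less_induct)
    case (less n)
    consider "n = 3 + 3" | "n = 3 + 4" | "n = 4 + 4" | "9 \<le> n" using less.prems by linarith
    then show ?case
    proof cases
      case 1
      show ?thesis unfolding 1 by (rule add[OF 3 3])
    next
      case 2
      show ?thesis unfolding 2 by (rule add[OF 3 4])
    next
      case 3
      show ?thesis unfolding 3 by (rule add[OF 4 4])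
    next
      case 4
      then have "?P (n - 3 + 3)" by (intro add[OF less.IH \<open>?P 3\<close>]) auto
      then show ?thesis using 4 by simp
    qed
  qed
qed

lemma ex_colouring_no_rainbow_bull:
  assumes s: "cycle_cover n s" and "5 \<le> n"
  shows "\<exists>c. \<not> has_rainbow_copy (complete_graph n) c bull \<and>
    card {i. i < n \<and> s i \<noteq> i} + 1 \<le> card (c ` edges (complete_graph n))"
proof -
  let ?M = "{i. i < n \<and> s i \<noteq> i}"
  define adj where "adj u v \<longleftrightarrow> v = s u \<or> u = s v" for u v
  \<comment> \<open>The edge \<open>{i, s i}\<close> gets the colour \<open>i\<close>, which it
    determines because \<open>s\<close> has no orbit of length two. The colour \<open>n\<close> is
    different from all of these and serves for the remaining edges.\<close>
  define c where "c e = (if \<exists>i\<in>?M. e = {i, s i} then THE i. i \<in> ?M \<and> e = {i, s i} else n)" for e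
  have inj: "u = v" if "s u = s v" "u < n" "v < n" for u v
    using s that unfolding cycle_cover_def inj_on_def by blast
  have s_lt: "s i < n" and s2: "s i \<noteq> i \<Longrightarrow> s (s i) \<noteq> i"
    and s34: "s (s (s i)) = i \<or> s (s (s (s i))) = i" if "i < n" for i
    using s that unfolding cycle_cover_def by blast+
  have cs: "c {i, s i} = i" if "i \<in> ?M" for i
  proof -
    have "(THE j. j \<in> ?M \<and> {i, s i} = {j, s j}) = i"
      using that s2[of i] by (intro the_equality) (auto simp: doubleton_eq_iff)
    then show ?thesis using that unfolding c_def by auto
  qed
  have cn: "c {u, v} = n \<or> adj u v" for u v
  proof (rule disjCI)
    assume "\<not> adj u v"
    then have "\<not> (\<exists>i\<in>?M. {u, v} = {i, s i})"
      unfolding adj_def by (auto simp: doubleton_eq_iff)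
    then show "c {u, v} = n" unfolding c_def by (simp only: if_False)
  qed
  have deg: "\<not> (adj u x \<and> adj u y \<and> adj u z)"
    if "u < n" "x < n" "y < n" "z < n" "distinct [x, y, z]" for u x y z
    using that inj unfolding adj_def by auto
  have "\<not> has_rainbow_copy (complete_graph n) c bull"
  proof
    assume "has_rainbow_copy (complete_graph n) c bull"
    then obtain a b x y z where V: "{a, b, x, y, z} \<subseteq> {..<n}" and D: "distinct [a, b, x, y, z]"
      and C: "distinct [c {a, b}, c {b, x}, c {a, x}, c {a, y}, c {b, z}]"
      by (rule has_rainbow_copy_bullE)
    \<comment> \<open>At most one edge of the bull has colour \<open>n\<close>. If \<open>ab\<close>
      were a cycle edge, then degree at most two at \<open>a\<close> and at \<open>b\<close> would
      force colour \<open>n\<close> twice; so \<open>ab\<close> itself has colour \<open>n\<close>,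
      and \<open>y\<close>, \<open>a\<close>, \<open>x\<close>, \<open>b\<close>, \<open>z\<close>
      is a path of cycle edges.\<close>
    have "\<not> (adj a x \<and> adj a y)" "\<not> (adj b x \<and> adj b z)" if "adj a b"
      using that deg[of a b x y] deg[of b a x z] V D by (auto simp: adj_def)
    moreover have "adj a x \<or> adj b x" "adj a x \<or> adj b z" "adj a y \<or> adj b x" "adj a y \<or> adj b z"
      using cn[of a x] cn[of a y] cn[of b x] cn[of b z] C by auto
    ultimately have "c {a, b} = n" using cn by blast
    with C have "n \<noteq> c {a, x}" "n \<noteq> c {a, y}" "n \<noteq> c {b, x}" "n \<noteq> c {b, z}"
      by simp_all
    then have adj: "adj a x" "adj a y" "adj b x" "adj b z"
      using cn by metis+
    \<comment> \<open>Injectivity of \<open>s\<close> orients the whole path \<open>u\<close>,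
      \<open>p\<close>, \<open>x\<close>, \<open>q\<close>, \<open>w\<close> along \<open>s\<close>,
      so neither the third nor the fourth iterate of \<open>s\<close> returns to
      \<open>u\<close>.\<close>
    have no_path: False
      if "x = s p" "q = s x" "adj p u" "adj q w" "{p, q, u, w} \<subseteq> {..<n}" "distinct [p, q, x, u, w]"
      for p q u w
    proof -
      have "s w \<noteq> q" "s p \<noteq> u" using inj[of w x] that V by auto
      then have "w = s q" "p = s u" using that(3,4) by (auto simp: adj_def)
      then have "s (s (s u)) = q" "s (s (s (s u))) = w" using that(1,2) by simp_all
      then show False using s34[of u] that(5,6) by auto
    qed
    have "\<not> (x = s a \<and> b = s x)" "\<not> (x = s b \<and> a = s x)"
      using no_path[of a b y z] no_path[of b a z y] adj V D by auto
    moreover have "\<not> (x = s a \<and> x = s b)" using inj[of a b] V D by auto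
    ultimately show False using adj(1,3) D unfolding adj_def distinct.simps by (metis list.set_intros)
  qed
  moreover have "card ?M + 1 \<le> card (c ` edges (complete_graph n))"
  proof -
    \<comment> \<open>The extra colour \<open>n\<close> does occur: vertex 0 has at most two cycle
      neighbours among at least four other vertices.\<close>
    have "\<exists>v<n. v \<noteq> 0 \<and> \<not> adj 0 v"
    proof (rule ccontr)
      assume "\<not> ?thesis"
      then have "adj 0 v" if "v < n" "v \<noteq> 0" for v using that by blast
      from this[of 1] this[of 2] this[of 3] have "adj 0 1" "adj 0 2" "adj 0 3"
        using \<open>5 \<le> n\<close> by simp_all
      then show False using deg[of 0 1 2 3] \<open>5 \<le> n\<close> by auto
    qed
    then obtain v where v: "v < n" "v \<noteq> 0" "c {0, v} = n" using cn by metis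
    have "n \<in> c ` edges (complete_graph n)"
      using v coloursI[of 0 "{..<n}" v "\<lambda>u v. c {u, v}"] unfolding image_edges_complete_graph
      by simp
    moreover have "i \<in> c ` edges (complete_graph n)" if "i \<in> ?M" for i
      using cs[OF that] s_lt[of i] that coloursI[of i "{..<n}" "s i" "\<lambda>u v. c {u, v}"]
      unfolding image_edges_complete_graph by simp
    ultimately have "insert n ?M \<subseteq> c ` edges (complete_graph n)" by blast
    moreover have "finite (c ` edges (complete_graph n))"
      unfolding image_edges_complete_graph by (rule finite_colours) simp
    ultimately have "card (insert n ?M) \<le> card (c ` edges (complete_graph n))"
      by (intro card_mono)
    then show ?thesis by simp
  qed
  ultimately show ?thesis by blast
qed

lemma rainbow_number_eqI:
  assumes "\<And>c. m + 1 \<le> card (c ` edges G) \<Longrightarrow> has_rainbow_copy G c H"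
    and "\<not> has_rainbow_copy G c H" "m \<le> card (c ` edges G)"
  shows "rainbow_number G H = m + 1"
  unfolding rainbow_number_def
proof (rule Least_equality)
  show "m + 1 \<le> k" if "\<forall>c. k \<le> card (c ` edges G) \<longrightarrow> has_rainbow_copy G c H" for k
  proof (rule ccontr)
    assume "\<not> ?thesis"
    then have "k \<le> card (c ` edges G)" using assms(3) by simp
    then show False using that assms(2) by blast
  qed
qed (use assms(1) in blast)

theorem theorem6:
  "rainbow_number (complete_graph 5) bull = 6 \<and>
   (\<forall>n\<ge>6. rainbow_number (complete_graph n) bull = n + 2)"
proof (intro conjI allI impI)
  \<comment> \<open>A 4-cycle with the fixed point 4, written in the form produced by
    \<open>cycle_cover_append\<close>; it gives four cycle colours and one more.\<close>
  let ?s = "\<lambda>i. if i < 4 then Suc i mod 4 else 4 + id (i - 4)"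
  have "cycle_cover 1 id" by (simp add: cycle_cover_def)
  from cycle_cover_append[OF cycle_cover_4 this] have s: "cycle_cover 5 ?s" by simp
  have "Suc i mod 4 \<noteq> i" for i by presburger
  then have "{i. i < 5 \<and> ?s i \<noteq> i} = {..<4}" by auto
  then have M: "card {i. i < 5 \<and> ?s i \<noteq> i} = 4" by simp
  then obtain c where "\<not> has_rainbow_copy (complete_graph 5) c bull"
      "5 \<le> card (c ` edges (complete_graph 5))"
    using ex_colouring_no_rainbow_bull[OF s] unfolding M by auto
  then have "rainbow_number (complete_graph 5) bull = 5 + 1"
    using rainbow_copy_bull[of 5] by (intro rainbow_number_eqI[of 5]) auto
  then show "rainbow_number (complete_graph 5) bull = 6" by simp
next
  fix n :: nat
  assume n: "6 \<le> n"
  obtain s where s: "cycle_cover n s" "\<forall>i<n. s i \<noteq> i" using ex_cycle_cover[OF n] by blast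
  then have "{i. i < n \<and> s i \<noteq> i} = {..<n}" by auto
  then obtain c where "\<not> has_rainbow_copy (complete_graph n) c bull"
      "n + 1 \<le> card (c ` edges (complete_graph n))"
    using ex_colouring_no_rainbow_bull[OF s(1)] n by auto
  then have "rainbow_number (complete_graph n) bull = n + 1 + 1"
    using rainbow_copy_bull[of n] n by (intro rainbow_number_eqI[of "n + 1"]) auto
  then show "rainbow_number (complete_graph n) bull = n + 2" by simp
qed

end
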